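(* Let $(x^k,\lambda^k)_{k\ge 0}$ be the iterates of the primal-dual algorithm described in the context, with $T\ge 1$ primal updates per iteration, primal stepsize $\alpha$ and dual stepsize $\beta$, and let $M=C^{-1}(I-\alpha B)^T$, where $C=\sum_{t=0}^{T-1}(I-\alpha B)^t$. Define $$z^k=\begin{bmatrix} x^k\\ \lambda^k\end{bmatrix},\qquad z^*=\begin{bmatrix} x^*\\ \lambda^*\end{bmatrix},\qquad G=\begin{bmatrix} M & \mathbf{0}\\ \mathbf{0} & \frac{\alpha}{\beta} I\end{bmatrix}.$$ Suppose each $f_i$ is $m$-strongly convex, twice differentiable and has $L$-Lipschitz gradient, and suppose the stepsizes satisfy $$0<\beta<\frac{2m}{\rho(A'A)},\qquad 0<\alpha<\frac{1-\left(\frac{L^2}{L^2+\eta\rho(B)}\right)^{1/T}}{\rho(B)}$$ for some $\eta$ with $0<\eta<2m-\beta\rho(A'A)$. Then there exists $\delta>0$ (independent of $k$) such that for all $k\ge 0$ $$\|z^{k+1}-z^*\|_G^2\le\frac{1}{1+\delta}\|z^k-z^*\|_G^2,$$ that is, $\|z^k-z^*\|_G$ converges Q-linearly to $0$, and consequently $\|x^k-x^*\|_M$ converges R-linearly to $0$.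
   Context: Notation: $'$ denotes transpose; $\|\cdot\|$ is the Euclidean norm; for a symmetric positive semidefinite matrix $S$, $\rho(S)$ is its largest eigenvalue and $\|v\|_S=\sqrt{v'Sv}$. A superscript $T$ on a matrix always denotes the $T$-th power (with $T$ a positive integer), never transpose. Graph: $\mathcal{G}=(\mathcal{V},\mathcal{E})$ is an undirected graph with $n\ge 2$ vertices. $A\in\mathbb{R}^{|\mathcal{E}|\times n}$ is its edge-node incidence matrix: the row of an edge connecting vertices $i$ and $j$ has $+1$ in column $i$ and $-1$ in column $j$ (or vice versa) and $0$ elsewhere. The null space of $A$ is spanned by the all-ones vector (i.e. the graph is connected). Assumption on the objective: $f_1,\dots,f_n:\mathbb{R}\to\mathbb{R}$ are twice differentiable, $m$-strongly convex with $m>0$, and have $L$-Lipschitz gradient, i.e. $m\le f_i''\le L$. For $x=[x_1,\dots,x_n]'\in\mathbb{R}^n$, $f(x)=\sum_{i=1}^n f_i(x_i)$. Assumption on $B$: $B\in\mathbb{R}^{n\times n}$ is symmetric positive semidefinite, has the same null space as $A$, and for $i\ne j$, $B_{ij}\neq 0$ only if $(i,j)\in\mathcal{E}$. Problem: $\min_{x\in\mathbb{R}^n} f(x)$ subject to $Ax=0$; $x^*$ is its unique minimizer and $\lambda^*\in\mathbb{R}^{|\mathcal{E}|}$ is the optimal dual solution (Lagrange multiplier, so $\nabla f(x^* )+A'\lambda^*=0$) whose projection onto the null space of $A'$ is $0$. Algorithm: fix an integer $T\ge1$ and stepsizes $\alpha,\beta>0$. Start from arbitrary $x^0\in\mathbb{R}^n$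 and $\lambda^0=0$. For $k=0,1,2,\dots$: set $x^{k+1,0}=x^k$; for $t=1,\dots,T$ set $x^{k+1,t}=x^{k+1,t-1}-\alpha\nabla f(x^k)-\alpha A'\lambda^k-\alpha Bx^{k+1,t-1}$; set $x^{k+1}=x^{k+1,T}$ and $\lambda^{k+1}=\lambda^k+\beta Ax^{k+1}$. Equivalently, with $C=\sum_{t=0}^{T-1}(I-\alpha B)^t$, $$x^{k+1}=(I-\alpha B)^Tx^k-\alpha C\nabla f(x^k)-\alpha CA'\lambda^k,\qquad \lambda^{k+1}=\lambda^k+\beta Ax^{k+1}.$$ Under the stepsize conditions $\alpha<1/\rho(B)$, so $C$ is invertible and $M$ is symmetric positive definite. Q-linear convergence of a nonnegative sequence $a_k$ to $0$ means $a_{k+1}\le c\,a_k$ for some $c\in(0,1)$ and all $k$; R-linear convergence means $a_k$ is bounded by a nonnegative sequence converging Q-linearly to $0$. *)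

theory Defs
  imports "HOL-Analysis.Analysis"
begin

text \<open>The operators \<open>*\<close>, \<open>^\<close> and \<open>1\<close> on type \<^typ>\<open>real^'n^'n\<close> act entrywise,
  so powers with respect to the matrix product are defined separately.\<close>

definition mat_pow :: "real^'n^'n \<Rightarrow> nat \<Rightarrow> real^'n^'n"
  where "mat_pow S k = (((**) S) ^^ k) (mat 1)"

definition null_space :: "real^'n^'m \<Rightarrow> (real^'n) set"
  where "null_space S = {v. S *v v = 0}"

definition sym_psd :: "real^'n^'n \<Rightarrow> bool"
  where "sym_psd S \<longleftrightarrow> transpose S = S \<and> (\<forall>v. 0 \<le> v \<bullet> (S *v v))"

definition is_eigenvalue :: "real^'n^'n \<Rightarrow> real \<Rightarrow> bool"
  where "is_eigenvalue S \<mu> \<longleftrightarrow> (\<exists>v. v \<noteq> 0 \<and> S *v v = \<mu> *\<^sub>R v)"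

text \<open>Only used for symmetric matrices, where the set of real eigenvalues is finite and
  nonempty.\<close>

definition max_eigenvalue :: "real^'n^'n \<Rightarrow> real"
  where "max_eigenvalue S = Max {\<mu>. is_eigenvalue S \<mu>}"

definition wnorm :: "real^'n^'n \<Rightarrow> real^'n \<Rightarrow> real"
  where "wnorm S v = sqrt (v \<bullet> (S *v v))"

definition stack :: "real^'n \<Rightarrow> real^'e \<Rightarrow> real^('n + 'e)"
  where "stack x l = (\<chi> s. case s of Inl i \<Rightarrow> x $ i | Inr e \<Rightarrow> l $ e)"

definition block_diag :: "real^'n^'n \<Rightarrow> real^'e^'e \<Rightarrow> real^('n + 'e)^('n + 'e)"
  where "block_diag P Q = (\<chi> r c. case (r, c) of
      (Inl i, Inl j) \<Rightarrow> P $ i $ j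
    | (Inr d, Inr e) \<Rightarrow> Q $ d $ e
    | _ \<Rightarrow> 0)"

definition undirected_graph :: "'n set set \<Rightarrow> bool"
  where "undirected_graph E \<longleftrightarrow> (\<forall>s\<in>E. card s = 2)"

text \<open>The rows of the incidence matrix are indexed by a finite type \<open>'e\<close> which enumerates the
  edge set via \<open>ends\<close>; the orientation of each edge is arbitrary.\<close>

definition incidence_matrix :: "'n set set \<Rightarrow> ('e \<Rightarrow> 'n set) \<Rightarrow> real^'n^'e \<Rightarrow> bool"
  where "incidence_matrix E ends A \<longleftrightarrow>
    bij_betw ends UNIV E \<and>
    (\<forall>e. \<exists>i j. i \<noteq> j \<and> ends e = {i, j} \<and> A $ e $ i = 1 \<and> A $ e $ j = - 1 \<and>
        (\<forall>k. k \<noteq> i \<longrightarrow> k \<noteq> j \<longrightarrow> A $ e $ k = 0))"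

definition twice_differentiable :: "(real \<Rightarrow> real) \<Rightarrow> bool"
  where "twice_differentiable g \<longleftrightarrow>
    (\<forall>x. g differentiable at x) \<and> (\<forall>x. deriv g differentiable at x)"

definition strongly_convex :: "real \<Rightarrow> (real \<Rightarrow> real) \<Rightarrow> bool"
  where "strongly_convex m g \<longleftrightarrow> (\<forall>x y. \<forall>t\<in>{0..1}.
    g ((1 - t) * x + t * y) \<le> (1 - t) * g x + t * g y - m / 2 * (t * (1 - t)) * (x - y)\<^sup>2)"

definition objective :: "('n \<Rightarrow> real \<Rightarrow> real) \<Rightarrow> real^'n \<Rightarrow> real"
  where "objective f x = (\<Sum>i\<in>UNIV. f i (x $ i))"

definition gradient :: "(real^'n \<Rightarrow> real) \<Rightarrow> real^'n \<Rightarrow> real^'n"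
  where "gradient F x = (THE D. GDERIV F x :> D)"

definition primal_optimal :: "(real^'n \<Rightarrow> real) \<Rightarrow> real^'n^'e \<Rightarrow> real^'n \<Rightarrow> bool"
  where "primal_optimal F A x \<longleftrightarrow> is_arg_min F (\<lambda>y. A *v y = 0) x"

text \<open>Lagrangian dual function of the problem of minimizing \<open>F\<close> subject to \<open>A *v x = 0\<close>;
  extended reals allow for the value \<open>-\<infinity>\<close>.\<close>

definition dual_function :: "(real^'n \<Rightarrow> real) \<Rightarrow> real^'n^'e \<Rightarrow> real^'e \<Rightarrow> ereal"
  where "dual_function F A l = (INF x. ereal (F x + l \<bullet> (A *v x)))"

definition dual_optimal :: "(real^'n \<Rightarrow> real) \<Rightarrow> real^'n^'e \<Rightarrow> real^'e \<Rightarrow> bool"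
  where "dual_optimal F A l \<longleftrightarrow> is_arg_max (dual_function F A) (\<lambda>_. True) l"

definition primal_step ::
    "(real^'n \<Rightarrow> real) \<Rightarrow> real^'n^'e \<Rightarrow> real^'n^'n \<Rightarrow> real \<Rightarrow> real^'n \<Rightarrow> real^'e \<Rightarrow> real^'n \<Rightarrow> real^'n"
  where "primal_step F A B \<alpha> xk lk y =
    y - \<alpha> *\<^sub>R gradient F xk - \<alpha> *\<^sub>R (transpose A *v lk) - \<alpha> *\<^sub>R (B *v y)"

definition primal_dual_iterates ::
    "(real^'n \<Rightarrow> real) \<Rightarrow> real^'n^'e \<Rightarrow> real^'n^'n \<Rightarrow> nat \<Rightarrow> real \<Rightarrow> real \<Rightarrow>
      (nat \<Rightarrow> real^'n) \<Rightarrow> (nat \<Rightarrow> real^'e) \<Rightarrow> bool"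
  where "primal_dual_iterates F A B T \<alpha> \<beta> x l \<longleftrightarrow>
    l 0 = 0 \<and>
    (\<forall>k. x (Suc k) = ((primal_step F A B \<alpha> (x k) (l k)) ^^ T) (x k)) \<and>
    (\<forall>k. l (Suc k) = l k + \<beta> *\<^sub>R (A *v x (Suc k)))"

definition C_mat :: "real^'n^'n \<Rightarrow> nat \<Rightarrow> real \<Rightarrow> real^'n^'n"
  where "C_mat B T \<alpha> = (\<Sum>t<T. mat_pow (mat 1 - \<alpha> *\<^sub>R B) t)"

definition M_mat :: "real^'n^'n \<Rightarrow> nat \<Rightarrow> real \<Rightarrow> real^'n^'n"
  where "M_mat B T \<alpha> = matrix_inv (C_mat B T \<alpha>) ** mat_pow (mat 1 - \<alpha> *\<^sub>R B) T"

definition G_mat :: "real^'n^'n \<Rightarrow> nat \<Rightarrow> real \<Rightarrow> real \<Rightarrow> real^('n + 'e::finite)^('n + 'e)"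
  where "G_mat B T \<alpha> \<beta> = block_diag (M_mat B T \<alpha>) ((\<alpha> / \<beta>) *\<^sub>R mat 1)"

definition Q_linear :: "(nat \<Rightarrow> real) \<Rightarrow> bool"
  where "Q_linear a \<longleftrightarrow> (\<forall>k. 0 \<le> a k) \<and> (\<exists>c. 0 < c \<and> c < 1 \<and> (\<forall>k. a (Suc k) \<le> c * a k))"

definition R_linear :: "(nat \<Rightarrow> real) \<Rightarrow> bool"
  where "R_linear a \<longleftrightarrow> (\<forall>k. 0 \<le> a k) \<and> (\<exists>b. Q_linear b \<and> (\<forall>k. a k \<le> b k))"

end

theory Submission
  imports Defs
begin

text \<open>With \<open>S = I - \<alpha> B\<close>, telescoping gives \<open>\<alpha> B C = I - S^T\<close>, hence \<open>C\<^sup>-\<^sup>1 = M + \<alpha> B\<close>. Together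
  with the optimality condition \<open>\<nabla>f(x*) + A'\<lambda>* = 0\<close>, the errors \<open>e = x\<^sup>k\<^sup>+\<^sup>1 - x*\<close>, \<open>u = \<lambda>\<^sup>k\<^sup>+\<^sup>1 - \<lambda>*\<close>
  and the increment \<open>d = x\<^sup>k\<^sup>+\<^sup>1 - x\<^sup>k\<close> satisfy
  \<open>M d = - \<alpha> (\<nabla>f(x\<^sup>k) - \<nabla>f(x*) + A'u + (B - \<beta> A'A) e)\<close>.
  Pairing this with \<open>e\<close> shows that the squared \<open>G\<close>-norm of the error drops by at least a multiple of
  \<open>|e|\<^sup>2 + |d|\<^sup>2\<close>; the bound on \<open>\<alpha>\<close> says precisely that \<open>M > (\<alpha> L\<^sup>2 / \<eta>) I\<close>. Conversely
  \<open>|e|\<^sup>2 + |d|\<^sup>2\<close> controls the whole \<open>G\<close>-norm, because \<open>u\<close> stays in the range of \<open>A\<close>, where \<open>|u|\<close> is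
  bounded by a multiple of \<open>|A'u|\<close>, and the same equation expresses \<open>A'u\<close> through \<open>e\<close> and \<open>d\<close>.\<close>

section \<open>Symmetric matrices and ranges\<close>

lemma inner_matrix_vector_transpose:
  fixes S :: "real^'n^'m"
  shows "v \<bullet> (S *v w) = (transpose S *v v) \<bullet> w"
  by (simp add: dot_lmul_matrix)

text \<open>The function \<mu> |w|^2 - w . S w is nonnegative and vanishes at \<open>v\<close>, so
  its derivative at \<open>v\<close> along the residual \<open>r\<close> must vanish. That
  derivative is -2 |r|^2, hence \<open>r\<close> = 0.\<close>

lemma eigenvector_of_maximal_quotient:
  fixes S :: "real^'n^'n"
  assumes sym: "transpose S = S" and le: "\<And>w. w \<bullet> (S *v w) \<le> \<mu> * (w \<bullet> w)"
    and eq: "v \<bullet> (S *v v) = \<mu> * (v \<bullet> v)"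
  shows "S *v v = \<mu> *\<^sub>R v"
proof (rule ccontr)
  define r where "r = S *v v - \<mu> *\<^sub>R v"
  define q where "q = \<mu> * (r \<bullet> r) - r \<bullet> (S *v r)"
  assume "S *v v \<noteq> \<mu> *\<^sub>R v"
  then have r_pos: "r \<bullet> r > 0" by (simp add: r_def)
  have q_nonneg: "q \<ge> 0" using le[of r] by (simp add: q_def)
  have rr: "r \<bullet> r = r \<bullet> (S *v v) - \<mu> * (r \<bullet> v)"
    by (subst (2) r_def) (simp add: inner_diff_right)
  have expand: "2 * t * (r \<bullet> r) \<le> t\<^sup>2 * q" for t
  proof -
    have "v \<bullet> (S *v r) = r \<bullet> (S *v v)"
      using inner_matrix_vector_transpose[of v S r] sym by (simp add: inner_commute)
    then have quad: "(v + t *\<^sub>R r) \<bullet> (S *v (v + t *\<^sub>R r))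
        = v \<bullet> (S *v v) + 2 * t * (r \<bullet> (S *v v)) + t\<^sup>2 * (r \<bullet> (S *v r))"
      by (simp add: matrix_vector_right_distrib matrix_vector_mult_scaleR inner_add_left
          inner_add_right power2_eq_square algebra_simps)
    have sq: "(v + t *\<^sub>R r) \<bullet> (v + t *\<^sub>R r) = v \<bullet> v + 2 * t * (r \<bullet> v) + t\<^sup>2 * (r \<bullet> r)"
      by (simp add: inner_add_left inner_add_right inner_commute[of v r] power2_eq_square algebra_simps)
    have "2 * t * (r \<bullet> r) = 2 * t * (r \<bullet> (S *v v)) - 2 * t * \<mu> * (r \<bullet> v)"
      by (subst rr) (simp add: algebra_simps)
    moreover have "t\<^sup>2 * q = \<mu> * (t\<^sup>2 * (r \<bullet> r)) - t\<^sup>2 * (r \<bullet> (S *v r))"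
      by (simp add: q_def right_diff_distrib mult.left_commute)
    moreover have "\<mu> * (v \<bullet> v + 2 * t * (r \<bullet> v) + t\<^sup>2 * (r \<bullet> r))
        = \<mu> * (v \<bullet> v) + 2 * t * \<mu> * (r \<bullet> v) + \<mu> * (t\<^sup>2 * (r \<bullet> r))"
      by (simp add: distrib_left mult_ac)
    ultimately show ?thesis
      using le[of "v + t *\<^sub>R r", unfolded quad sq] eq by linarith
  qed
  \<comment> \<open>Any small positive \<open>t\<close> contradicts \<open>expand\<close>; this one
    makes \<open>t * q\<close> at most |r|^2, and the added 1 covers the case q = 0.\<close>
  define t where "t = (r \<bullet> r) / (q + 1)"
  have t_pos: "t > 0" using r_pos q_nonneg by (simp add: t_def)
  have "t * (2 * (r \<bullet> r)) \<le> t * (t * q)"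
    using expand[of t] by (simp add: power2_eq_square algebra_simps)
  then have "2 * (r \<bullet> r) \<le> t * q" using t_pos by (simp only: mult_le_cancel_left_pos)
  also have "t * q \<le> t * (q + 1)" using t_pos by simp
  also have "\<dots> = r \<bullet> r" using q_nonneg by (simp add: t_def)
  finally show False using r_pos by simp
qed

text \<open>Eigenvectors for distinct eigenvalues are orthogonal, hence independent, so the
  dimension bounds their number. Finiteness is what makes the \<open>Max\<close> in
  \<open>max_eigenvalue\<close> an upper bound of the eigenvalues.\<close>

lemma finite_eigenvalues_symmetric:
  fixes S :: "real^'n^'n"
  assumes sym: "transpose S = S"
  shows "finite {\<mu>. is_eigenvalue S \<mu>}"
proof -
  define ev where "ev \<mu> = (SOME v. v \<noteq> 0 \<and> S *v v = \<mu> *\<^sub>R v)" for \<mu>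
  have ev: "ev \<mu> \<noteq> 0 \<and> S *v ev \<mu> = \<mu> *\<^sub>R ev \<mu>" if "is_eigenvalue S \<mu>" for \<mu>
    using that unfolding is_eigenvalue_def ev_def by (rule someI_ex)
  let ?K = "{\<mu>. is_eigenvalue S \<mu>}"
  have orth: "ev a \<bullet> ev b = 0" if "a \<in> ?K" "b \<in> ?K" "a \<noteq> b" for a b
  proof -
    have "ev a \<bullet> (S *v ev b) = (S *v ev a) \<bullet> ev b"
      using inner_matrix_vector_transpose[of "ev a" S "ev b"] sym by simp
    then show ?thesis using ev[of a] ev[of b] that by simp
  qed
  have inj: "inj_on ev ?K"
  proof (intro inj_onI, rule ccontr)
    fix a b assume ab: "a \<in> ?K" "b \<in> ?K" "ev a = ev b" "a \<noteq> b"
    then have "ev a \<bullet> ev a = 0" using orth[of a b] by simp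
    then show False using ev[of a] ab by simp
  qed
  have "pairwise orthogonal (ev ` ?K)"
    using orth by (auto simp: pairwise_def orthogonal_def)
  moreover have "0 \<notin> ev ` ?K" 
  proof
    assume "0 \<in> ev ` ?K"
    then obtain a where "is_eigenvalue S a" "ev a = 0" by (auto elim: imageE)
    then show False using ev[of a] by blast
  qed
  ultimately have "independent (ev ` ?K)" by (rule pairwise_orthogonal_independent)
  then show ?thesis using inj independent_imp_finite finite_imageD by blast
qed

text \<open>The quadratic form attains its maximum on the compact unit sphere. A maximizer is an
  eigenvector, so the maximum is itself an eigenvalue; scaling transfers the bound to all
  vectors.\<close>

lemma inner_le_max_eigenvalue:
  fixes S :: "real^'n^'n"
  assumes sym: "transpose S = S"
  shows "v \<bullet> (S *v v) \<le> max_eigenvalue S * (v \<bullet> v)"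
proof -
  have "continuous_on (sphere (0::real^'n) 1) (\<lambda>w. w \<bullet> (S *v w))"
    by (intro continuous_intros matrix_vector_mult_linear_continuous_on)
  moreover have "sphere (0::real^'n) 1 \<noteq> {}" by simp
  ultimately obtain u where u: "norm u = 1"
    and max: "\<And>w. norm w = 1 \<Longrightarrow> w \<bullet> (S *v w) \<le> u \<bullet> (S *v u)"
    using continuous_attains_sup[OF compact_sphere, of "0::real^'n" 1 "\<lambda>w. w \<bullet> (S *v w)"] by auto
  define \<mu> where "\<mu> = u \<bullet> (S *v u)"
  have le: "w \<bullet> (S *v w) \<le> \<mu> * (w \<bullet> w)" for w
  proof (cases "w = 0")
    case False
    let ?c = "inverse (norm w)"
    have "(?c *\<^sub>R w) \<bullet> (S *v (?c *\<^sub>R w)) \<le> \<mu>"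
      unfolding \<mu>_def by (rule max) (simp add: False)
    moreover have "(?c *\<^sub>R w) \<bullet> (S *v (?c *\<^sub>R w)) = w \<bullet> (S *v w) / (norm w)\<^sup>2"
      by (simp add: matrix_vector_mult_scaleR power2_eq_square divide_simps)
    ultimately show ?thesis using False by (simp add: divide_le_eq dot_square_norm)
  qed simp
  have "S *v u = \<mu> *\<^sub>R u"
    by (rule eigenvector_of_maximal_quotient[OF sym le]) (simp add: \<mu>_def dot_square_norm u)
  then have "is_eigenvalue S \<mu>" unfolding is_eigenvalue_def using u by (intro exI[of _ u]) auto
  then have "\<mu> \<le> max_eigenvalue S"
    unfolding max_eigenvalue_def by (intro Max_ge finite_eigenvalues_symmetric sym) simp
  then show ?thesis using le[of v] by (meson inner_ge_zero mult_right_mono order_trans)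
qed

text \<open>The component \<open>n\<close> of \<open>g\<close> orthogonal to the range of S' lies in
  the kernel of \<open>S\<close>, so it is orthogonal to \<open>g\<close> and thus to itself. This
  supplies a multiplier in \<open>dual_optimal_stationary\<close> and later places
  \<open>lamstar\<close> in the range of \<open>A\<close>.\<close>

lemma orthogonal_to_kernel_in_range_transpose:
  fixes S :: "real^'n^'m"
  assumes orth: "\<And>v. S *v v = 0 \<Longrightarrow> v \<bullet> g = 0"
  shows "\<exists>y. g = transpose S *v y"
proof -
  have sub: "subspace (range ((*v) (transpose S)))"
    by (intro linear_subspace_image subspace_UNIV) simp
  obtain r n where g: "g = r + n" and r: "r \<in> span (range ((*v) (transpose S)))"
    and n: "\<And>w. w \<in> span (range ((*v) (transpose S))) \<Longrightarrow> orthogonal n w"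
    using orthogonal_subspace_decomp_exists[of "range ((*v) (transpose S))" g] by blast
  have "(S *v n) \<bullet> y = 0" for y
  proof -
    have "n \<bullet> (transpose S *v y) = 0"
      using n[OF span_base] by (simp add: orthogonal_def)
    then show ?thesis by (metis inner_matrix_vector_transpose transpose_transpose)
  qed
  then have "S *v n = 0" using inner_eq_zero_iff by blast
  then have "n \<bullet> g = 0" by (rule orth)
  moreover have "n \<bullet> r = 0" using n[OF r] by (simp add: orthogonal_def)
  ultimately have "n = 0" by (simp add: g inner_add_right)
  moreover have "r \<in> range ((*v) (transpose S))"
    using r unfolding span_eq_iff[THEN iffD2, OF sub] .
  ultimately show ?thesis using g by (metis add.right_neutral imageE)
qed

text \<open>If A'Aw = 0 then |Aw|^2 = w . A'Aw = 0, so A' is injective on the range of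
  \<open>A\<close>; an injective linear map on a closed finite-dimensional subspace is bounded
  below.\<close>

lemma transpose_bounded_below_on_range:
  fixes A :: "real^'n^'e"
  shows "\<exists>K>0. \<forall>w. norm (A *v w) \<le> K * norm (transpose A *v (A *v w))"
proof -
  have sub: "subspace (range ((*v) A))"
    by (intro linear_subspace_image subspace_UNIV) simp
  have "\<forall>u \<in> range ((*v) A). transpose A *v u = 0 \<longrightarrow> u = 0"
  proof safe
    fix w assume "transpose A *v (A *v w) = 0"
    then have "(A *v w) \<bullet> (A *v w) = 0" by (simp add: inner_matrix_vector_transpose)
    then show "A *v w = 0" by simp
  qed
  then obtain e where e: "e > 0" "\<forall>u \<in> range ((*v) A). norm (transpose A *v u) \<ge> e * norm u"
    using injective_imp_isometric[OF closed_subspace[OF sub] sub, of "(*v) (transpose A)"]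
    by (auto simp: matrix_vector_mul_bounded_linear)
  have "norm (A *v w) \<le> inverse e * norm (transpose A *v (A *v w))" for w
    using e by (auto simp: field_simps)
  then show ?thesis using e by (intro exI[of _ "inverse e"]) auto
qed

lemma matrix_norm_bound:
  fixes S :: "real^'n^'m"
  shows "\<exists>K>0. \<forall>v. norm (S *v v) \<le> K * norm v"
  using bounded_linear.pos_bounded[OF matrix_vector_mul_bounded_linear[of S]]
  by (auto simp: mult.commute)

section \<open>Matrix powers and the matrices C and M\<close>

lemma mat_pow_0_vector [simp]: "mat_pow S 0 *v v = v"
  by (simp add: mat_pow_def)

lemma mat_pow_Suc: "mat_pow S (Suc k) = S ** mat_pow S k"
  by (simp add: mat_pow_def)

lemma mat_pow_Suc_vector: "mat_pow S (Suc k) *v v = S *v (mat_pow S k *v v)"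
  by (simp add: mat_pow_Suc matrix_vector_mul_assoc)

lemma mat_pow_add_vector: "mat_pow S (i + j) *v v = mat_pow S i *v (mat_pow S j *v v)"
  by (induction i) (simp_all add: mat_pow_Suc_vector)

lemma inner_mat_pow_symmetric:
  assumes "transpose S = S"
  shows "v \<bullet> (mat_pow S k *v w) = (mat_pow S k *v v) \<bullet> w"
proof (induction k arbitrary: v)
  case (Suc k)
  have "v \<bullet> (mat_pow S (Suc k) *v w) = (S *v v) \<bullet> (mat_pow S k *v w)"
    using inner_matrix_vector_transpose[of v S] assms by (simp add: mat_pow_Suc_vector)
  also have "\<dots> = (mat_pow S k *v (S *v v)) \<bullet> w" by (rule Suc)
  also have "mat_pow S k *v (S *v v) = mat_pow S (Suc k) *v v"
    using mat_pow_add_vector[of S k 1 v] by (simp add: mat_pow_Suc_vector)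
  finally show ?case .
qed simp

text \<open>Even and odd powers reduce to the two base cases \<open>p \<bullet> (S - s) p \<ge> 0\<close> and
  \<open>p \<bullet> S (S - s) p = |(S - s) p|\<^sup>2 + s (p \<bullet> (S - s) p) \<ge> 0\<close>, which replaces the spectral
  theorem.\<close>

lemma mat_pow_quadratic_step:
  fixes S :: "real^'n^'n"
  assumes sym: "transpose S = S" and s: "0 \<le> s" and lower: "\<And>v. s * (v \<bullet> v) \<le> v \<bullet> (S *v v)"
  shows "s * (w \<bullet> (mat_pow S i *v w)) \<le> w \<bullet> (mat_pow S (Suc i) *v w)"
proof -
  \<comment> \<open>By symmetry half of the power moves to each side: w . S^(2h+j) w = p . S^j p.
    With h = i div 2 only j = 0, 1, 2 occur.\<close>
  define h where "h = i div 2"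
  define p where "p = mat_pow S h *v w"
  have split: "w \<bullet> (mat_pow S (h + (j + h)) *v w) = p \<bullet> (mat_pow S j *v p)" for j
    unfolding p_def mat_pow_add_vector by (rule inner_mat_pow_symmetric[OF sym])
  have one: "mat_pow S 1 *v v = S *v v" for v by (simp add: mat_pow_Suc_vector)
  have two: "mat_pow S 2 *v v = S *v (S *v v)" for v
    by (simp add: mat_pow_Suc_vector numeral_2_eq_2)
  show ?thesis
  proof (cases "even i")
    case True
    then have "i = h + (0 + h)" "Suc i = h + (1 + h)" by (auto simp: h_def)
    then show ?thesis using split[of 0] split[of 1] lower[of p] one by simp
  next
    case False
    then have i: "i = h + (1 + h)" "Suc i = h + (2 + h)" by (auto simp: h_def elim: oddE)
    have "0 \<le> (S *v p - s *\<^sub>R p) \<bullet> (S *v p - s *\<^sub>R p) + s * (p \<bullet> (S *v p) - s * (p \<bullet> p))"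
      using lower[of p] s by simp
    also have "\<dots> = (S *v p) \<bullet> (S *v p) - s * (p \<bullet> (S *v p))"
      by (simp add: inner_diff_left inner_diff_right inner_commute[of "S *v p" p] algebra_simps)
    also have "(S *v p) \<bullet> (S *v p) = p \<bullet> (S *v (S *v p))"
      using inner_matrix_vector_transpose[of p S "S *v p"] sym by simp
    finally show ?thesis using i split[of 1] split[of 2] one two by simp
  qed
qed

lemma mat_pow_quadratic_nonneg:
  fixes S :: "real^'n^'n"
  assumes sym: "transpose S = S" and s: "0 \<le> s" and lower: "\<And>v. s * (v \<bullet> v) \<le> v \<bullet> (S *v v)"
  shows "0 \<le> w \<bullet> (mat_pow S i *v w)"
proof (induction i)
  case (Suc i)
  then have "0 \<le> s * (w \<bullet> (mat_pow S i *v w))" using s by simp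
  then show ?case using mat_pow_quadratic_step[OF sym s lower, of w i] by linarith
qed simp

lemma mat_pow_quadratic_mono:
  fixes S :: "real^'n^'n"
  assumes sym: "transpose S = S" and s: "0 \<le> s" and lower: "\<And>v. s * (v \<bullet> v) \<le> v \<bullet> (S *v v)"
  shows "s ^ k * (w \<bullet> (mat_pow S i *v w)) \<le> w \<bullet> (mat_pow S (k + i) *v w)"
proof (induction k)
  case (Suc k)
  have "s ^ Suc k * (w \<bullet> (mat_pow S i *v w)) \<le> s * (w \<bullet> (mat_pow S (k + i) *v w))"
    using mult_left_mono[OF Suc s] by (simp add: mult_ac)
  also have "\<dots> \<le> w \<bullet> (mat_pow S (Suc k + i) *v w)"
    using mat_pow_quadratic_step[OF sym s lower] by simp
  finally show ?case .
qed simp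

section \<open>The geometric sum C, its inverse and the matrix M\<close>

lemma sum_mat_vector:
  fixes P :: "'a \<Rightarrow> real^'n^'m"
  shows "(\<Sum>t\<in>I. P t) *v v = (\<Sum>t\<in>I. P t *v v)"
proof (cases "finite I")
  case True
  then show ?thesis by induction (simp_all add: matrix_vector_mult_add_rdistrib)
qed simp

lemma matrix_inv_cancel:
  fixes C :: "real^'n^'n"
  assumes "invertible C"
  shows "C *v (matrix_inv C *v v) = v" "matrix_inv C *v (C *v v) = v"
proof -
  have "C ** matrix_inv C = mat 1 \<and> matrix_inv C ** C = mat 1"
    using assms unfolding invertible_def matrix_inv_def by (rule someI_ex)
  then show "C *v (matrix_inv C *v v) = v" "matrix_inv C *v (C *v v) = v"
    by (simp_all add: matrix_vector_mul_assoc)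
qed

lemma geometric_matrix_sum:
  fixes B :: "real^'n^'n"
  shows "\<alpha> *\<^sub>R (B *v (C_mat B T \<alpha> *v v)) = v - mat_pow (mat 1 - \<alpha> *\<^sub>R B) T *v v"
proof -
  have "\<alpha> *\<^sub>R (B *v (C_mat B T \<alpha> *v v)) + mat_pow (mat 1 - \<alpha> *\<^sub>R B) T *v v = v"
  proof (induction T)
    case (Suc T)
    let ?p = "mat_pow (mat 1 - \<alpha> *\<^sub>R B) T *v v"
    have "mat_pow (mat 1 - \<alpha> *\<^sub>R B) (Suc T) *v v = ?p - \<alpha> *\<^sub>R (B *v ?p)"
      by (simp add: mat_pow_Suc_vector matrix_vector_mult_diff_rdistrib scaleR_matrix_vector_assoc)
    moreover have "C_mat B (Suc T) \<alpha> *v v = C_mat B T \<alpha> *v v + ?p"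
      by (simp add: C_mat_def matrix_vector_mult_add_rdistrib)
    ultimately show ?case using Suc
      by (simp add: matrix_vector_right_distrib scaleR_right_distrib)
  qed (simp add: C_mat_def)
  then show ?thesis by (simp add: eq_diff_eq)
qed

lemma transpose_gradient_step_matrix:
  fixes B :: "real^'n^'n"
  assumes "transpose B = B"
  shows "transpose (mat 1 - \<alpha> *\<^sub>R B) = mat 1 - \<alpha> *\<^sub>R B"
proof -
  have "transpose (mat 1 - \<alpha> *\<^sub>R B) = transpose (mat 1) - \<alpha> *\<^sub>R transpose B"
    by (simp add: transpose_def vec_eq_iff)
  then show ?thesis using assms by simp
qed

lemma C_mat_vector: "C_mat B T \<alpha> *v v = (\<Sum>t<T. mat_pow (mat 1 - \<alpha> *\<^sub>R B) t *v v)"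
  by (simp add: C_mat_def sum_mat_vector)

text \<open>The quadratic form of C is a sum of nonnegative terms whose term for t = 0 is |v|^2,
  present because T \<ge> 1. Hence C v = 0 forces v = 0.\<close>

lemma invertible_C_mat:
  fixes B :: "real^'n^'n"
  assumes sym: "transpose B = B" and s: "0 \<le> s" and T: "T \<ge> 1"
    and lower: "\<And>v. s * (v \<bullet> v) \<le> v \<bullet> ((mat 1 - \<alpha> *\<^sub>R B) *v v)"
  shows "invertible (C_mat B T \<alpha>)"
proof -
  have "v = 0" if zero: "C_mat B T \<alpha> *v v = 0" for v
  proof -
    let ?a = "\<lambda>t. v \<bullet> (mat_pow (mat 1 - \<alpha> *\<^sub>R B) t *v v)"
    have nonneg: "0 \<le> ?a t" for t
      using mat_pow_quadratic_nonneg[OF transpose_gradient_step_matrix[OF sym] s lower] .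
    have "(\<Sum>t<T. ?a t) = v \<bullet> (C_mat B T \<alpha> *v v)"
      by (simp add: C_mat_vector inner_sum_right)
    then have "(\<Sum>t<T. ?a t) = 0" using zero by simp
    moreover have "?a 0 \<le> (\<Sum>t<T. ?a t)"
      using T nonneg by (intro member_le_sum) simp_all
    ultimately have "\<not> 0 < v \<bullet> v" by (simp del: inner_gt_zero_iff)
    then show ?thesis by simp
  qed
  then have "inj ((*v) (C_mat B T \<alpha>))"
    by (metis inj_matrix_vector_mult matrix_left_invertible_injective matrix_left_invertible_ker)
  then show ?thesis
    by (simp add: invertible_left_inverse matrix_left_invertible_injective)
qed

lemma C_mat_mat_pow_commute:
  "C_mat B T \<alpha> *v (mat_pow (mat 1 - \<alpha> *\<^sub>R B) k *v v)
    = mat_pow (mat 1 - \<alpha> *\<^sub>R B) k *v (C_mat B T \<alpha> *v v)"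
proof -
  have "C_mat B T \<alpha> *v (mat_pow (mat 1 - \<alpha> *\<^sub>R B) k *v v)
      = (\<Sum>t<T. mat_pow (mat 1 - \<alpha> *\<^sub>R B) (t + k) *v v)"
    by (simp add: C_mat_vector mat_pow_add_vector)
  also have "\<dots> = (\<Sum>t<T. mat_pow (mat 1 - \<alpha> *\<^sub>R B) (k + t) *v v)"
    by (simp add: add.commute)
  also have "\<dots> = mat_pow (mat 1 - \<alpha> *\<^sub>R B) k *v (C_mat B T \<alpha> *v v)"
    by (simp add: C_mat_vector mat_pow_add_vector linear_sum[OF matrix_vector_mul_linear])
  finally show ?thesis .
qed

lemma inner_C_mat_symmetric:
  fixes B :: "real^'n^'n"
  assumes sym: "transpose B = B"
  shows "v \<bullet> (C_mat B T \<alpha> *v w) = (C_mat B T \<alpha> *v v) \<bullet> w"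
  using inner_mat_pow_symmetric[OF transpose_gradient_step_matrix[OF sym]]
  by (simp add: C_mat_vector inner_sum_right inner_sum_left)

text \<open>On vectors C w the inverse inside \<open>M_mat\<close> cancels, since C commutes with
  the powers of I - \<alpha> B. \<open>M_mat_plus\<close>, \<open>inner_M_mat_symmetric\<close> and
  \<open>M_mat_lower_bound\<close> all substitute v = C w to exploit this.\<close>

lemma M_mat_C_mat:
  fixes B :: "real^'n^'n"
  assumes inv: "invertible (C_mat B T \<alpha>)"
  shows "M_mat B T \<alpha> *v (C_mat B T \<alpha> *v w) = mat_pow (mat 1 - \<alpha> *\<^sub>R B) T *v w"
  by (simp add: M_mat_def C_mat_mat_pow_commute[symmetric] matrix_inv_cancel[OF inv]
      flip: matrix_vector_mul_assoc)

lemma M_mat_plus: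
  fixes B :: "real^'n^'n"
  assumes inv: "invertible (C_mat B T \<alpha>)"
  shows "matrix_inv (C_mat B T \<alpha>) *v v = M_mat B T \<alpha> *v v + \<alpha> *\<^sub>R (B *v v)"
proof -
  define w where "w = matrix_inv (C_mat B T \<alpha>) *v v"
  have v: "v = C_mat B T \<alpha> *v w" by (simp add: w_def matrix_inv_cancel[OF inv])
  have "M_mat B T \<alpha> *v v + \<alpha> *\<^sub>R (B *v v) = w"
    unfolding v M_mat_C_mat[OF inv] geometric_matrix_sum by simp
  then show ?thesis by (simp add: w_def)
qed

lemma inner_M_mat_symmetric:
  fixes B :: "real^'n^'n"
  assumes sym: "transpose B = B" and inv: "invertible (C_mat B T \<alpha>)"
  shows "v \<bullet> (M_mat B T \<alpha> *v w) = (M_mat B T \<alpha> *v v) \<bullet> w"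
proof -
  define p where "p = matrix_inv (C_mat B T \<alpha>) *v v"
  define q where "q = matrix_inv (C_mat B T \<alpha>) *v w"
  have vw: "v = C_mat B T \<alpha> *v p" "w = C_mat B T \<alpha> *v q"
    by (simp_all add: p_def q_def matrix_inv_cancel[OF inv])
  show ?thesis
    unfolding vw M_mat_C_mat[OF inv]
    by (simp add: inner_mat_pow_symmetric[OF transpose_gradient_step_matrix[OF sym]]
        inner_C_mat_symmetric[OF sym] C_mat_mat_pow_commute)
qed

text \<open>On an eigenvector of S = I - \<alpha> B with eigenvalue \<sigma>, M acts as \<sigma>^T /
  (1 + ... + \<sigma>^(T-1)), which increases with \<sigma>. Instead of diagonalizing, v = C w turns
  both sides into double sums of a_i = w . S^i w, compared term by term via a_(i+k) \<ge> s^k a_i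
  with k = T - t.\<close>

lemma M_mat_lower_bound:
  fixes B :: "real^'n^'n"
  assumes sym: "transpose B = B" and s: "0 \<le> s"
    and lower: "\<And>v. s * (v \<bullet> v) \<le> v \<bullet> ((mat 1 - \<alpha> *\<^sub>R B) *v v)"
    and inv: "invertible (C_mat B T \<alpha>)"
  shows "s ^ T * (v \<bullet> v) \<le> (\<Sum>t<T. s ^ t) * (v \<bullet> (M_mat B T \<alpha> *v v))"
proof -
  let ?S = "mat 1 - \<alpha> *\<^sub>R B"
  have symS: "transpose ?S = ?S" by (rule transpose_gradient_step_matrix[OF sym])
  define w where "w = matrix_inv (C_mat B T \<alpha>) *v v"
  have v: "v = C_mat B T \<alpha> *v w" by (simp add: w_def matrix_inv_cancel[OF inv])
  define a where "a i = w \<bullet> (mat_pow ?S i *v w)" for i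
  have vv: "v \<bullet> v = (\<Sum>j<T. \<Sum>t<T. a (j + t))"
    unfolding v C_mat_vector a_def inner_sum_left inner_sum_right mat_pow_add_vector
    by (simp add: inner_mat_pow_symmetric[OF symS])
      (subst sum.swap, simp)
  have vMv: "v \<bullet> (M_mat B T \<alpha> *v v) = (\<Sum>j<T. a (j + T))"
    unfolding v M_mat_C_mat[OF inv]
    unfolding C_mat_vector a_def inner_sum_left mat_pow_add_vector
    by (simp only: inner_mat_pow_symmetric[OF symS])
  have "s ^ T * a (j + t) \<le> s ^ t * a (j + T)" if "t < T" for j t
  proof -
    have "s ^ (T - t) * a (j + t) \<le> a ((T - t) + (j + t))"
      unfolding a_def by (rule mat_pow_quadratic_mono[OF symS s lower])
    then have "s ^ t * (s ^ (T - t) * a (j + t)) \<le> s ^ t * a (j + T)"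
      using that s by (intro mult_left_mono) (simp_all add: add.commute)
    then show ?thesis using that by (simp add: mult.assoc[symmetric] flip: power_add)
  qed
  then have "(\<Sum>j<T. \<Sum>t<T. s ^ T * a (j + t)) \<le> (\<Sum>j<T. \<Sum>t<T. s ^ t * a (j + T))"
    by (intro sum_mono) auto
  then show ?thesis
    unfolding vv vMv sum_product sum_distrib_left by (simp add: sum_distrib_right)
qed

text \<open>Gradient and multiplier stay frozen during the inner loop, so each step is one affine
  map y \<mapsto> S y - \<alpha> h with S = I - \<alpha> B; iterating it accumulates the geometric
  sum C.\<close>

lemma primal_step_funpow:
  fixes B :: "real^'n^'n"
  shows "((primal_step F A B \<alpha> xk lk) ^^ T) y = mat_pow (mat 1 - \<alpha> *\<^sub>R B) T *v y
    - \<alpha> *\<^sub>R (C_mat B T \<alpha> *v (gradient F xk + transpose A *v lk))"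
proof (induction T)
  case (Suc T)
  let ?h = "gradient F xk + transpose A *v lk"
  have S: "(mat 1 - \<alpha> *\<^sub>R B) *v v = v - \<alpha> *\<^sub>R (B *v v)" for v
    by (simp add: matrix_vector_mult_diff_rdistrib scaleR_matrix_vector_assoc)
  \<comment> \<open>Splitting off the term t = 0 rather than the last one gives C_(T+1) = S C_T + I,
    the recursion that matches one more step applied on the left.\<close>
  have C: "C_mat B (Suc T) \<alpha> *v ?h = (mat 1 - \<alpha> *\<^sub>R B) *v (C_mat B T \<alpha> *v ?h) + ?h"
    unfolding C_mat_vector sum.lessThan_Suc_shift
    by (simp add: mat_pow_Suc_vector linear_sum[OF matrix_vector_mul_linear])
  have "((primal_step F A B \<alpha> xk lk) ^^ Suc T) y = (mat 1 - \<alpha> *\<^sub>R B) *v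
      (mat_pow (mat 1 - \<alpha> *\<^sub>R B) T *v y - \<alpha> *\<^sub>R (C_mat B T \<alpha> *v ?h)) - \<alpha> *\<^sub>R ?h"
    unfolding funpow.simps o_def Suc S primal_step_def
    by (simp add: scaleR_right_distrib algebra_simps)
  also have "\<dots> = mat_pow (mat 1 - \<alpha> *\<^sub>R B) (Suc T) *v y - \<alpha> *\<^sub>R (C_mat B (Suc T) \<alpha> *v ?h)"
    unfolding C
    by (simp add: mat_pow_Suc_vector matrix_vector_mult_diff_distrib matrix_vector_mult_scaleR
        scaleR_right_distrib)
  finally show ?case .
qed (simp add: C_mat_def)

text \<open>Removes the root from the stepsize condition: q^(1/T) < 1 - \<alpha> \<rho> is raised to
  the power T and the denominator of q is cleared.\<close>

lemma stepsize_power_bound: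
  fixes L \<alpha> \<eta> \<rho> :: real
  assumes rho: "0 < \<rho>" and eta: "0 < \<eta>" and T: "T \<ge> 1"
    and alpha: "\<alpha> < (1 - (L\<^sup>2 / (L\<^sup>2 + \<eta> * \<rho>)) powr (1 / real T)) / \<rho>"
  shows "0 < 1 - \<alpha> * \<rho>" "L\<^sup>2 < (1 - \<alpha> * \<rho>) ^ T * (L\<^sup>2 + \<eta> * \<rho>)"
proof -
  define q where "q = L\<^sup>2 / (L\<^sup>2 + \<eta> * \<rho>)"
  have den: "0 < L\<^sup>2 + \<eta> * \<rho>" using rho eta by (intro add_nonneg_pos) auto
  have q: "0 \<le> q" using den by (simp add: q_def)
  \<comment> \<open>The case q = 0, that is L = 0, is separate because \<open>powr_realpow\<close>
    requires a positive base.\<close>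
  have "(q powr (1 / real T)) ^ T = q"
    using q T by (cases "q = 0") (simp_all add: powr_powr flip: powr_realpow)
  moreover have less: "q powr (1 / real T) < 1 - \<alpha> * \<rho>"
    using alpha rho by (simp add: pos_less_divide_eq flip: q_def)
  ultimately have "q < (1 - \<alpha> * \<rho>) ^ T"
    using T power_strict_mono[OF less, of T] by simp
  then show "L\<^sup>2 < (1 - \<alpha> * \<rho>) ^ T * (L\<^sup>2 + \<eta> * \<rho>)"
    using den by (simp add: q_def pos_divide_less_eq)
  show "0 < 1 - \<alpha> * \<rho>" using less powr_ge_zero[of q "1 / real T"] by linarith
qed

text \<open>With s = 1 - \<alpha> \<rho> and \<Sigma> = 1 + ... + s^(T-1), M dominates (s^T /
  \<Sigma>) I. Since \<alpha> \<rho> \<Sigma> = 1 - s^T, the power bound L^2 (1 - s^T) < \<eta>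
  \<rho> s^T says exactly that s^T / \<Sigma> exceeds \<alpha> L^2 / \<eta>; \<open>c\<close> is the
  gap.\<close>

lemma M_mat_coercive:
  fixes B :: "real^'n^'n"
  assumes sym: "transpose B = B" and rho: "0 < \<rho>" and alpha_pos: "0 < \<alpha>" and eta: "0 < \<eta>"
    and upper: "\<And>v. v \<bullet> (B *v v) \<le> \<rho> * (v \<bullet> v)" and T: "T \<ge> 1"
    and alpha: "\<alpha> < (1 - (L\<^sup>2 / (L\<^sup>2 + \<eta> * \<rho>)) powr (1 / real T)) / \<rho>"
  shows "invertible (C_mat B T \<alpha>)"
    and "\<exists>c>0. \<forall>v. (\<alpha> * L\<^sup>2 / \<eta> + c) * (v \<bullet> v) \<le> v \<bullet> (M_mat B T \<alpha> *v v)"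
proof -
  define s where "s = 1 - \<alpha> * \<rho>"
  have s: "0 < s" and key: "L\<^sup>2 < s ^ T * (L\<^sup>2 + \<eta> * \<rho>)"
    using stepsize_power_bound[OF rho eta T alpha] by (simp_all add: s_def)
  have lower: "s * (v \<bullet> v) \<le> v \<bullet> ((mat 1 - \<alpha> *\<^sub>R B) *v v)" for v
  proof -
    have "\<alpha> * (v \<bullet> (B *v v)) \<le> \<alpha> * (\<rho> * (v \<bullet> v))"
      using upper[of v] alpha_pos by (intro mult_left_mono) auto
    moreover have "v \<bullet> ((mat 1 - \<alpha> *\<^sub>R B) *v v) = v \<bullet> v - \<alpha> * (v \<bullet> (B *v v))"
      by (simp add: matrix_vector_mult_diff_rdistrib inner_diff_right flip: scaleR_matrix_vector_assoc)
    ultimately show ?thesis by (simp add: s_def algebra_simps)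
  qed
  show inv: "invertible (C_mat B T \<alpha>)"
    using s by (intro invertible_C_mat[OF sym _ T lower]) simp
  define \<Sigma> where "\<Sigma> = (\<Sum>t<T. s ^ t)"
  have Sigma_pos: "0 < \<Sigma>"
    unfolding \<Sigma>_def using s T by (intro sum_pos) (auto simp: lessThan_empty_iff bot_nat_def)
  have geom: "\<alpha> * \<rho> * \<Sigma> = 1 - s ^ T"
    using one_diff_power_eq[of s T] by (simp add: s_def \<Sigma>_def)
  have "\<rho> * (\<alpha> * L\<^sup>2 * \<Sigma>) = L\<^sup>2 * (1 - s ^ T)" by (simp add: mult_ac flip: geom)
  also have "\<dots> < \<rho> * (\<eta> * s ^ T)" using key by (simp add: algebra_simps)
  finally have "\<alpha> * L\<^sup>2 * \<Sigma> < \<eta> * s ^ T" using rho by simp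
  then have gap: "\<alpha> * L\<^sup>2 / \<eta> < s ^ T / \<Sigma>"
    using eta Sigma_pos by (simp add: field_simps)
  have "(s ^ T / \<Sigma>) * (v \<bullet> v) \<le> v \<bullet> (M_mat B T \<alpha> *v v)" for v
    using M_mat_lower_bound[OF sym _ lower inv, of v] s Sigma_pos
    by (simp add: pos_divide_le_eq mult.commute flip: \<Sigma>_def)
  then show "\<exists>c>0. \<forall>v. (\<alpha> * L\<^sup>2 / \<eta> + c) * (v \<bullet> v) \<le> v \<bullet> (M_mat B T \<alpha> *v v)"
    using gap by (intro exI[of _ "s ^ T / \<Sigma> - \<alpha> * L\<^sup>2 / \<eta>"]) simp
qed

section \<open>Separable strongly convex objectives\<close>

text \<open>Subtracting m/2 u^2 leaves a convex function \<open>h\<close>, because the square falls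
  below its chord by exactly t (1 - t) (u - v)^2; the claim is the tangent inequality of
  \<open>h\<close>.\<close>

lemma strongly_convex_tangent:
  assumes diff: "\<And>x. g differentiable at x" and conv: "strongly_convex m g"
  shows "g x + deriv g x * (y - x) + m / 2 * (y - x)\<^sup>2 \<le> g y"
proof -
  define h where "h u = g u - m / 2 * u\<^sup>2" for u
  have "convex_on UNIV h"
  proof (intro convex_onI)
    fix t u v :: real assume t: "0 < t" "t < 1"
    have "m / 2 * (t * (1 - t)) * (u - v)\<^sup>2
        = (1 - t) * (m / 2 * u\<^sup>2) + t * (m / 2 * v\<^sup>2) - m / 2 * ((1 - t) * u + t * v)\<^sup>2"
      by (simp add: power2_eq_square field_simps)
    moreover have "g ((1 - t) * u + t * v)
        \<le> (1 - t) * g u + t * g v - m / 2 * (t * (1 - t)) * (u - v)\<^sup>2"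
      using conv t by (simp add: strongly_convex_def)
    moreover have "(1 - t) * h u = (1 - t) * g u - (1 - t) * (m / 2 * u\<^sup>2)"
      "t * h v = t * g v - t * (m / 2 * v\<^sup>2)"
      by (simp_all add: h_def right_diff_distrib)
    ultimately show "h ((1 - t) *\<^sub>R u + t *\<^sub>R v) \<le> (1 - t) * h u + t * h v"
      unfolding real_scaleR_def h_def[of "(1 - t) * u + t * v"] by linarith
  qed simp
  moreover have "(h has_real_derivative deriv g x - m * x) (at x)"
    unfolding h_def using diff[of x]
    by (auto intro!: derivative_eq_intros simp: DERIV_deriv_iff_real_differentiable)
  ultimately have "(deriv g x - m * x) * (y - x) \<le> h y - h x"
    by (intro convex_on_imp_above_tangent[where A = UNIV]) auto
  then show ?thesis
    by (simp add: h_def power2_eq_square algebra_simps)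
qed

text \<open>Sum of the tangent inequalities at \<open>x\<close> and at \<open>y\<close>.\<close>

lemma strongly_convex_deriv_monotone:
  assumes diff: "\<And>x. g differentiable at x" and conv: "strongly_convex m g"
  shows "m * (x - y)\<^sup>2 \<le> (deriv g x - deriv g y) * (x - y)"
  using strongly_convex_tangent[OF assms, of x y] strongly_convex_tangent[OF assms, of y x]
  by (simp add: power2_eq_square algebra_simps)

section \<open>Gradient of the separable objective\<close>

lemma gderiv_objective:
  assumes diff: "\<And>i x. f i differentiable at x"
  shows "GDERIV (objective f) x :> (\<chi> i. deriv (f i) (x $ i))"
proof -
  have "((\<lambda>x. f i (x $ i)) has_derivative (\<lambda>h. deriv (f i) (x $ i) * h $ i)) (at x)" for i
  proof -
    have "(f i has_derivative (*) (deriv (f i) (x $ i))) (at (x $ i))"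
      using diff[of i "x $ i"]
      by (simp add: DERIV_deriv_iff_real_differentiable[symmetric] has_field_derivative_def)
    moreover have "((\<lambda>x. x $ i) has_derivative (\<lambda>h. h $ i)) (at x)"
      by (intro bounded_linear.has_derivative[OF bounded_linear_vec_nth] has_derivative_ident)
    ultimately show ?thesis
      by (auto dest: has_derivative_compose)
  qed
  then have "((\<lambda>x. \<Sum>i\<in>UNIV. f i (x $ i)) has_derivative
      (\<lambda>h. \<Sum>i\<in>UNIV. deriv (f i) (x $ i) * h $ i)) (at x)"
    by (intro has_derivative_sum) auto
  moreover have "objective f = (\<lambda>x. \<Sum>i\<in>UNIV. f i (x $ i))" by (rule ext) (simp add: objective_def)
  ultimately show ?thesis by (simp add: gderiv_def inner_vec_def mult.commute)
qed

lemma gradient_eqI: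
  assumes "GDERIV F x :> D"
  shows "gradient F x = D"
  unfolding gradient_def
proof (rule the_equality)
  show "GDERIV F x :> D" by (rule assms)
  fix D' assume "GDERIV F x :> D'"
  then have "(\<lambda>h. h \<bullet> D') = (\<lambda>h. h \<bullet> D)"
    using assms unfolding gderiv_def by (rule has_derivative_unique)
  \<comment> \<open>The two equal functionals are tested at D' - D, where they differ by |D' -
    D|^2.\<close>
  then have "(D' - D) \<bullet> D' = (D' - D) \<bullet> D" by (rule fun_cong)
  then have "(D' - D) \<bullet> (D' - D) = 0" by (simp only: inner_diff_right)
  then show "D' = D" by simp
qed

lemma gradient_objective:
  assumes "\<And>i x. f i differentiable at x"
  shows "gradient (objective f) x = (\<chi> i. deriv (f i) (x $ i))"
  by (rule gradient_eqI[OF gderiv_objective[OF assms]])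

text \<open>Fermat's rule on the line through \<open>x\<close> in direction \<open>v\<close>. It
  serves twice: along ker A at the constrained minimizer, and in every direction for the
  Lagrangian.\<close>

lemma gradient_line_min:
  assumes D: "GDERIV F x :> D" and min: "\<And>t. F x \<le> F (x + t *\<^sub>R v)"
  shows "v \<bullet> D = 0"
proof -
  have "((\<lambda>t. F (x + t *\<^sub>R v)) has_derivative (\<lambda>t. (t *\<^sub>R v) \<bullet> D)) (at 0)"
  proof (rule has_derivative_compose[of "\<lambda>t. x + t *\<^sub>R v" "\<lambda>t. t *\<^sub>R v" _ _ F])
    show "((\<lambda>t. x + t *\<^sub>R v) has_derivative (\<lambda>t. t *\<^sub>R v)) (at 0)"
      by (auto intro!: derivative_eq_intros)
    show "(F has_derivative (\<lambda>h. h \<bullet> D)) (at (x + 0 *\<^sub>R v))"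
      using D by (simp add: gderiv_def)
  qed
  then have "((\<lambda>t. F (x + t *\<^sub>R v)) has_real_derivative v \<bullet> D) (at 0)"
    by (simp add: has_field_derivative_def mult_commute_abs)
  then show ?thesis by (rule DERIV_local_min[of _ _ _ 1]) (use min in auto)
qed

lemma objective_tangent:
  assumes diff: "\<And>i x. f i differentiable at x" and conv: "\<And>i. strongly_convex m (f i)"
    and m: "0 \<le> m"
  shows "objective f x + (y - x) \<bullet> gradient (objective f) x \<le> objective f y"
proof -
  have "f i (x $ i) + (y $ i - x $ i) * deriv (f i) (x $ i) \<le> f i (y $ i)" for i
  proof -
    have "0 \<le> m / 2 * (y $ i - x $ i)\<^sup>2" using m by simp
    then show ?thesis
      using strongly_convex_tangent[OF diff conv, of i "x $ i" "y $ i"]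
      unfolding mult.commute[of "deriv (f i) (x $ i)"] by linarith
  qed
  then show ?thesis
    by (simp add: objective_def[of f] gradient_objective[of f, OF diff] inner_vec_def sum_mono
        flip: sum.distrib)
qed

lemma gradient_objective_monotone:
  assumes diff: "\<And>i x. f i differentiable at x" and conv: "\<And>i. strongly_convex m (f i)"
  shows "m * (norm (x - y))\<^sup>2
    \<le> (x - y) \<bullet> (gradient (objective f) x - gradient (objective f) y)"
  unfolding power2_norm_eq_inner gradient_objective[of f, OF diff] inner_vec_def sum_distrib_left
  using strongly_convex_deriv_monotone[OF diff conv]
  by (intro sum_mono) (simp add: power2_eq_square mult_ac)

lemma gradient_objective_lipschitz:
  assumes diff: "\<And>i x. f i differentiable at x"
    and lip: "\<And>i. L-lipschitz_on UNIV (deriv (f i))"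
  shows "norm (gradient (objective f) x - gradient (objective f) y) \<le> L * norm (x - y)"
proof -
  have L: "0 \<le> L" using lip lipschitz_on_nonneg by blast
  have "(deriv (f i) (x $ i) - deriv (f i) (y $ i))\<^sup>2 \<le> L\<^sup>2 * (x $ i - y $ i)\<^sup>2" for i
  proof -
    have "\<bar>deriv (f i) (x $ i) - deriv (f i) (y $ i)\<bar> \<le> L * \<bar>x $ i - y $ i\<bar>"
      using lipschitz_onD[OF lip[of i], of "x $ i" "y $ i"] by (simp add: dist_real_def)
    then have "\<bar>deriv (f i) (x $ i) - deriv (f i) (y $ i)\<bar>\<^sup>2 \<le> (L * \<bar>x $ i - y $ i\<bar>)\<^sup>2"
      by (intro power_mono) auto
    then show ?thesis by (simp add: power_mult_distrib)
  qed
  then have "(norm (gradient (objective f) x - gradient (objective f) y))\<^sup>2 \<le> L\<^sup>2 * (norm (x - y))\<^sup>2"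
    unfolding power2_norm_eq_inner gradient_objective[of f, OF diff] inner_vec_def sum_distrib_left
    by (intro sum_mono) (simp add: power2_eq_square)
  then have "(norm (gradient (objective f) x - gradient (objective f) y))\<^sup>2 \<le> (L * norm (x - y))\<^sup>2"
    by (simp add: power_mult_distrib)
  then show ?thesis using L by (auto intro: power2_le_imp_le)
qed

text \<open>A dual maximizer \<open>l\<close> is a multiplier for \<open>x\<close> because the duality gap is zero: then \<open>x\<close>
  minimizes the Lagrangian at \<open>l\<close>, whose gradient vanishes.\<close>

lemma dual_optimal_stationary:
  fixes A :: "real^'n^'e"
  assumes diff: "\<And>i x. f i differentiable at x" and conv: "\<And>i. strongly_convex m (f i)"
    and m: "0 \<le> m"
    and primal: "primal_optimal (objective f) A x" and dual: "dual_optimal (objective f) A l"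
  shows "A *v x = 0" "gradient (objective f) x + transpose A *v l = 0"
proof -
  let ?F = "objective f" and ?g = "gradient (objective f) x"
  have GD: "GDERIV ?F x :> ?g"
    using gderiv_objective[of f, OF diff] gradient_objective[of f, OF diff] by simp
  show Ax: "A *v x = 0" using primal by (simp add: primal_optimal_def is_arg_min_def)
  have "v \<bullet> ?g = 0" if "A *v v = 0" for v
  proof (rule gradient_line_min[OF GD])
    fix t
    have "A *v (x + t *\<^sub>R v) = 0"
      using Ax that by (simp add: matrix_vector_right_distrib matrix_vector_mult_scaleR)
    then show "?F x \<le> ?F (x + t *\<^sub>R v)"
      using primal by (auto simp: primal_optimal_def is_arg_min_def not_less)
  qed
  \<comment> \<open>Primal optimality only makes the gradient orthogonal to ker A, hence of the form
    A'y. So -y is some multiplier, not yet the given \<open>l\<close>.\<close>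
  then obtain y where "?g = transpose A *v y"
    using orthogonal_to_kernel_in_range_transpose by blast
  then have g: "?g = - (transpose A *v (- y))"
    by (metis add.inverse_inverse linear_neg matrix_vector_mul_linear)
  \<comment> \<open>By convexity the Lagrangian at -y is at least F(x) everywhere, so the dual value
    at -y is at least F(x). Dual optimality then carries this bound over to
    \<open>l\<close>.\<close>
  have "?F x \<le> ?F u + (- y) \<bullet> (A *v u)" for u
  proof -
    have "(- y) \<bullet> (A *v u) = (- y) \<bullet> (A *v (u - x))"
      using Ax by (simp add: matrix_vector_mult_diff_distrib)
    also have "\<dots> = - ((u - x) \<bullet> ?g)"
      unfolding g inner_matrix_vector_transpose by (simp only: inner_minus_right inner_commute minus_minus)
    finally show ?thesis using objective_tangent[of f, OF diff conv m, of x u] by simp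
  qed
  then have "ereal (?F x) \<le> dual_function ?F A (- y)"
    unfolding dual_function_def by (intro INF_greatest) simp
  also have "\<dots> \<le> dual_function ?F A l"
    using dual by (simp add: dual_optimal_def is_arg_max_def not_less)
  finally have lag: "?F x \<le> ?F u + l \<bullet> (A *v u)" for u
    unfolding dual_function_def by (metis (no_types, lifting) INF_lower UNIV_I ereal_less_eq(3) order_trans)
  have "GDERIV (\<lambda>u. ?F u + l \<bullet> (A *v u)) x :> ?g + transpose A *v l"
  proof (rule GDERIV_add[OF GD])
    have "((\<lambda>u. u \<bullet> (transpose A *v l)) has_derivative (\<lambda>h. h \<bullet> (transpose A *v l))) (at x)"
      by (intro bounded_linear.has_derivative[OF bounded_linear_inner_left] has_derivative_ident)
    then show "GDERIV (\<lambda>u. l \<bullet> (A *v u)) x :> transpose A *v l"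
      unfolding gderiv_def inner_matrix_vector_transpose inner_commute[of "transpose A *v l"] .
  qed
  then have "v \<bullet> (?g + transpose A *v l) = 0" for v
    by (rule gradient_line_min) (use lag Ax in simp)
  then show "?g + transpose A *v l = 0" using inner_eq_zero_iff by blast
qed

section \<open>Contraction of the weighted error\<close>

text \<open>\<open>e\<close> and \<open>u\<close> are the new errors, e - d and u - \<beta> A e the
  old ones. In the old energy the coupling (A e) . u enters with 2 \<alpha> from -2 e . M d and with
  -2 \<alpha> from the dual square; the dual weight \<alpha> / \<beta> makes the two cancel.\<close>

lemma energy_identity:
  fixes M B :: "real^'n^'n" and A :: "real^'n^'e"
  assumes sym: "\<And>v w. v \<bullet> (M *v w) = (M *v v) \<bullet> w" and beta: "\<beta> \<noteq> 0"
    and step: "M *v d = - \<alpha> *\<^sub>R (g + transpose A *v u + (B *v e - \<beta> *\<^sub>R (transpose A *v (A *v e))))"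
  shows "e \<bullet> (M *v e) + \<alpha> / \<beta> * (u \<bullet> u)
    = (e - d) \<bullet> (M *v (e - d)) + \<alpha> / \<beta> * ((u - \<beta> *\<^sub>R (A *v e)) \<bullet> (u - \<beta> *\<^sub>R (A *v e)))
      - 2 * \<alpha> * (e \<bullet> g) - 2 * \<alpha> * (e \<bullet> (B *v e)) + \<alpha> * \<beta> * (norm (A *v e))\<^sup>2 - d \<bullet> (M *v d)"
proof -
  have adj: "e \<bullet> (transpose A *v y) = (A *v e) \<bullet> y" for y
    using inner_matrix_vector_transpose[of e "transpose A" y] by simp
  have "e \<bullet> (M *v d) = - \<alpha> * (e \<bullet> g + (A *v e) \<bullet> u + (e \<bullet> (B *v e) - \<beta> * (norm (A *v e))\<^sup>2))"
    unfolding step power2_norm_eq_inner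
    by (simp only: inner_scaleR_right inner_add_right inner_diff_right adj)
  also have "\<dots> = \<alpha> * \<beta> * (norm (A *v e))\<^sup>2 - \<alpha> * (e \<bullet> g) - \<alpha> * ((A *v e) \<bullet> u) - \<alpha> * (e \<bullet> (B *v e))"
    by (simp add: algebra_simps)
  finally have "e \<bullet> (M *v d)
      = \<alpha> * \<beta> * (norm (A *v e))\<^sup>2 - \<alpha> * (e \<bullet> g) - \<alpha> * ((A *v e) \<bullet> u) - \<alpha> * (e \<bullet> (B *v e))" .
  moreover have "(e - d) \<bullet> (M *v (e - d)) = e \<bullet> (M *v e) - 2 * (e \<bullet> (M *v d)) + d \<bullet> (M *v d)"
    using sym[of d e] by (simp add: matrix_vector_mult_diff_distrib inner_diff_left
        inner_diff_right inner_commute[of "M *v d" e])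
  moreover have "\<alpha> / \<beta> * ((u - \<beta> *\<^sub>R (A *v e)) \<bullet> (u - \<beta> *\<^sub>R (A *v e)))
      = \<alpha> / \<beta> * (u \<bullet> u) - 2 * \<alpha> * ((A *v e) \<bullet> u) + \<alpha> * \<beta> * (norm (A *v e))\<^sup>2"
  proof -
    have sq: "(u - \<beta> *\<^sub>R (A *v e)) \<bullet> (u - \<beta> *\<^sub>R (A *v e))
        = u \<bullet> u - 2 * \<beta> * ((A *v e) \<bullet> u) + \<beta>\<^sup>2 * (norm (A *v e))\<^sup>2"
      unfolding power2_norm_eq_inner
      by (simp add: inner_diff_left inner_diff_right inner_commute[of u "A *v e"]
          power2_eq_square[of \<beta>] right_diff_distrib)
    show ?thesis unfolding sq using beta by (simp add: field_simps power2_eq_square)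
  qed
  ultimately show ?thesis by linarith
qed

text \<open>In use, \<open>g\<close> and \<open>g'\<close> are the gradient differences to the
  optimum at the old and at the new iterate. Choosing \<delta> before quantifying over the errors
  keeps the rate independent of the iteration index.\<close>

lemma energy_contraction:
  fixes M B :: "real^'n^'n" and A :: "real^'n^'e"
  assumes sym: "\<And>v w. v \<bullet> (M *v w) = (M *v v) \<bullet> w"
    and coercive: "\<And>v. (\<alpha> * L\<^sup>2 / \<eta> + c) * (v \<bullet> v) \<le> v \<bullet> (M *v v)" and c: "0 < c"
    and alpha: "0 < \<alpha>" and beta: "0 < \<beta>" and eta: "0 < \<eta>" and L: "0 \<le> L"
    and A_le: "\<And>v. (norm (A *v v))\<^sup>2 \<le> \<rho> * (norm v)\<^sup>2" and eta_less: "\<eta> < 2 * m - \<beta> * \<rho>"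
    and B_psd: "\<And>v. 0 \<le> v \<bullet> (B *v v)"
  shows "\<exists>\<delta>>0. \<forall>e d g g' u w. m * (norm e)\<^sup>2 \<le> e \<bullet> g' \<longrightarrow> norm (g' - g) \<le> L * norm d \<longrightarrow>
      norm g \<le> L * norm (e - d) \<longrightarrow> u = A *v w \<longrightarrow>
      M *v d = - \<alpha> *\<^sub>R (g + transpose A *v u + (B *v e - \<beta> *\<^sub>R (transpose A *v (A *v e)))) \<longrightarrow>
      (1 + \<delta>) * (e \<bullet> (M *v e) + \<alpha> / \<beta> * (u \<bullet> u))
        \<le> (e - d) \<bullet> (M *v (e - d)) + \<alpha> / \<beta> * ((u - \<beta> *\<^sub>R (A *v e)) \<bullet> (u - \<beta> *\<^sub>R (A *v e)))"
proof -
  obtain KM where KM: "KM > 0" "\<And>v. norm (M *v v) \<le> KM * norm v"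
    using matrix_norm_bound by metis
  define Q where "Q = B - \<beta> *\<^sub>R (transpose A ** A)"
  have Q: "Q *v v = B *v v - \<beta> *\<^sub>R (transpose A *v (A *v v))" for v
    by (simp add: Q_def matrix_vector_mult_diff_rdistrib matrix_vector_mul_assoc
        flip: scaleR_matrix_vector_assoc)
  obtain KQ where KQ: "KQ > 0" "\<And>v. norm (Q *v v) \<le> KQ * norm v"
    using matrix_norm_bound by metis
  obtain KA where KA: "KA > 0" "\<And>w. norm (A *v w) \<le> KA * norm (transpose A *v (A *v w))"
    using transpose_bounded_below_on_range by metis
  \<comment> \<open>\<open>H\<close> will bound |A'u| in terms of |e| + |d|, \<open>K\<close> the
    new energy in terms of |e|^2 + |d|^2, and \<kappa> is the guaranteed decrease per unit of |e|^2
    + |d|^2. The witness for \<delta> is \<kappa> / K.\<close>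
  define H where "H = KM / \<alpha> + L + KQ"
  define K where "K = KM + 2 * (\<alpha> / \<beta>) * (KA * H)\<^sup>2"
  define \<kappa> where "\<kappa> = min (\<alpha> * (2 * m - \<eta> - \<beta> * \<rho>)) (c)"
  have K: "K > 0" using KM alpha beta by (auto simp: K_def intro!: add_pos_nonneg)
  have \<kappa>: "\<kappa> > 0" using alpha eta_less c by (simp add: \<kappa>_def)
  show ?thesis
  proof (intro exI[of _ "\<kappa> / K"] conjI allI impI)
    show "0 < \<kappa> / K" using K \<kappa> by simp
    fix e d g g' u w
    assume mono: "m * (norm e)\<^sup>2 \<le> e \<bullet> g'" and lip: "norm (g' - g) \<le> L * norm d"
      and g: "norm g \<le> L * norm (e - d)" and u: "u = A *v w"
      and step: "M *v d = - \<alpha> *\<^sub>R (g + transpose A *v u + (B *v e - \<beta> *\<^sub>R (transpose A *v (A *v e))))"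
    let ?new = "e \<bullet> (M *v e) + \<alpha> / \<beta> * (u \<bullet> u)"
    let ?old = "(e - d) \<bullet> (M *v (e - d)) + \<alpha> / \<beta> * ((u - \<beta> *\<^sub>R (A *v e)) \<bullet> (u - \<beta> *\<^sub>R (A *v e)))"
    define X where "X = (norm e)\<^sup>2"
    define D where "D = (norm d)\<^sup>2"
    have XD: "0 \<le> X" "0 \<le> D" by (simp_all add: X_def D_def)
    have decrease: "\<kappa> * (X + D) \<le> ?old - ?new"
    proof -
      have "e \<bullet> (g' - g) \<le> norm e * (L * norm d)"
        using norm_cauchy_schwarz[of e "g' - g"] lip by (meson mult_left_mono norm_ge_zero order_trans)
      \<comment> \<open>Young's inequality with weight \<eta>: monotonicity holds at the new iterate
        while the step uses the old gradient. The price \<eta> X is paid from 2 m X, and L^2 /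
        \<eta> D by the coercivity of M.\<close>
      moreover have "2 * (norm e * (L * norm d)) \<le> \<eta> * X + L\<^sup>2 / \<eta> * D"
      proof -
        have "0 \<le> (\<eta> * norm e - L * norm d)\<^sup>2 / \<eta>" using eta by simp
        also have "\<dots> = \<eta> * X + L\<^sup>2 / \<eta> * D - 2 * (norm e * (L * norm d))"
          using eta by (simp add: X_def D_def power2_eq_square field_simps)
        finally show ?thesis by simp
      qed
      ultimately have "(2 * m - \<eta>) * X - L\<^sup>2 / \<eta> * D \<le> 2 * (e \<bullet> g)"
        using mono by (simp add: X_def inner_diff_right algebra_simps)
      then have "\<alpha> * ((2 * m - \<eta>) * X - L\<^sup>2 / \<eta> * D) \<le> \<alpha> * (2 * (e \<bullet> g))"
        using alpha by (intro mult_left_mono) auto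
      then have 1: "\<alpha> * (2 * m - \<eta>) * X - \<alpha> * L\<^sup>2 / \<eta> * D \<le> 2 * \<alpha> * (e \<bullet> g)"
        by (simp add: right_diff_distrib mult_ac)
      have 2: "\<alpha> * \<beta> * (norm (A *v e))\<^sup>2 \<le> \<alpha> * \<beta> * \<rho> * X"
        using mult_left_mono[OF A_le[of e], of "\<alpha> * \<beta>"] alpha beta by (simp add: X_def mult_ac)
      have 3: "\<alpha> * L\<^sup>2 / \<eta> * D + c * D \<le> d \<bullet> (M *v d)"
        using coercive[of d] by (simp add: D_def power2_norm_eq_inner distrib_right)
      have 4: "0 \<le> 2 * \<alpha> * (e \<bullet> (B *v e))" using B_psd[of e] alpha by simp
      have "\<kappa> * (X + D) = \<kappa> * X + \<kappa> * D" by (simp add: distrib_left)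
      also have "\<dots> \<le> \<alpha> * (2 * m - \<eta> - \<beta> * \<rho>) * X + c * D"
        using XD by (intro add_mono mult_right_mono) (auto simp: \<kappa>_def)
      also have "\<dots> = \<alpha> * (2 * m - \<eta>) * X - \<alpha> * \<beta> * \<rho> * X + c * D" by (simp add: algebra_simps)
      also have "\<dots> \<le> ?old - ?new"
        using energy_identity[OF sym _ step] beta 1 2 3 4 by linarith
      finally show ?thesis .
    qed
    have bound: "?new \<le> K * (X + D)"
    proof -
      \<comment> \<open>The step equation is solved for A'u; since \<open>u\<close> lies in the
        range of \<open>A\<close>, the constant \<open>KA\<close> then turns a bound on A'u into one
        on \<open>u\<close>.\<close>
      have "transpose A *v u = - ((1 / \<alpha>) *\<^sub>R (M *v d) + g + Q *v e)"
        unfolding step Q using alpha by simp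
      then have "norm (transpose A *v u) \<le> norm ((1 / \<alpha>) *\<^sub>R (M *v d)) + norm g + norm (Q *v e)"
        by (simp only: norm_minus_cancel)
          (intro norm_triangle_le add_right_mono norm_triangle_ineq)
      also have "norm ((1 / \<alpha>) *\<^sub>R (M *v d)) \<le> KM / \<alpha> * norm d"
        using KM(2)[of d] alpha by (simp add: divide_right_mono)
      also have "norm g \<le> L * (norm e + norm d)"
        using g mult_left_mono[OF norm_triangle_ineq4[of e d] L] by linarith
      also have "norm (Q *v e) \<le> KQ * norm e" by (rule KQ)
      also have "KM / \<alpha> * norm d + L * (norm e + norm d) + KQ * norm e \<le> H * (norm e + norm d)"
      proof -
        have "0 \<le> KM / \<alpha> * norm e" "0 \<le> KQ * norm d" using KM KQ alpha by simp_all
        then show ?thesis unfolding H_def distrib_right distrib_left by linarith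
      qed
      finally have "norm (transpose A *v u) \<le> H * (norm e + norm d)" by simp
      then have "KA * norm (transpose A *v u) \<le> KA * (H * (norm e + norm d))"
        using KA(1) by (intro mult_left_mono) auto
      then have "norm u \<le> KA * H * (norm e + norm d)"
        using KA(2)[of w] unfolding u by simp
      then have "(norm u)\<^sup>2 \<le> (KA * H * (norm e + norm d))\<^sup>2"
        by (intro power_mono) auto
      then have "(norm u)\<^sup>2 \<le> (KA * H)\<^sup>2 * (norm e + norm d)\<^sup>2"
        by (simp only: power_mult_distrib)
      also have "(norm e + norm d)\<^sup>2 \<le> 2 * (X + D)"
        unfolding X_def D_def using zero_le_power2[of "norm e - norm d"]
        by (simp add: power2_sum power2_diff)
      finally have uu: "u \<bullet> u \<le> (KA * H)\<^sup>2 * (2 * (X + D))"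
        by (simp add: mult_left_mono power2_norm_eq_inner)
      have dual: "\<alpha> / \<beta> * (u \<bullet> u) \<le> \<alpha> / \<beta> * ((KA * H)\<^sup>2 * (2 * (X + D)))"
        using uu alpha beta by (intro mult_left_mono) auto
      have "e \<bullet> (M *v e) \<le> KM * (X + D)"
      proof -
        have "e \<bullet> (M *v e) \<le> norm e * (KM * norm e)"
          using norm_cauchy_schwarz[of e "M *v e"] KM(2)[of e]
          by (meson mult_left_mono norm_ge_zero order_trans)
        also have "\<dots> = KM * X" by (simp add: X_def power2_eq_square)
        also have "\<dots> \<le> KM * (X + D)" using KM XD by simp
        finally show ?thesis .
      qed
      then have "?new \<le> KM * (X + D) + \<alpha> / \<beta> * ((KA * H)\<^sup>2 * (2 * (X + D)))"
        using dual by (rule add_mono)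
      also have "\<dots> = K * (X + D)" by (simp add: K_def distrib_right)
      finally show ?thesis .
    qed
    \<comment> \<open>The two estimates combine to \<kappa> / K new \<le> \<kappa> (X + D) \<le> old
      - new.\<close>
    have "\<kappa> / K * ?new \<le> \<kappa> / K * (K * (X + D))"
      using bound K \<kappa> by (intro mult_left_mono) auto
    also have "\<dots> = \<kappa> * (X + D)" using K by simp
    also note decrease
    finally have "?new + \<kappa> / K * ?new \<le> ?old" by (simp only: le_diff_eq add.commute)
    then show "(1 + \<kappa> / K) * ?new \<le> ?old" by (simp only: distrib_right mult_1_left)
  qed
qed

section \<open>Stacked primal-dual vectors and the G-norm\<close>

lemma stack_diff: "stack x l - stack y k = stack (x - y) (l - k)"
  by (simp add: stack_def vec_eq_iff split: sum.split)

lemma sum_UNIV_Plus: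
  fixes h :: "'a::finite + 'b::finite \<Rightarrow> 'c::comm_monoid_add"
  shows "(\<Sum>s\<in>UNIV. h s) = (\<Sum>i\<in>UNIV. h (Inl i)) + (\<Sum>j\<in>UNIV. h (Inr j))"
  unfolding UNIV_Plus_UNIV[symmetric] by (subst sum.Plus) auto

lemma block_diag_stack: "block_diag P Q *v stack x l = stack (P *v x) (Q *v l)"
  by (simp add: vec_eq_iff matrix_vector_mult_def sum_UNIV_Plus block_diag_def stack_def
      split: sum.split)

lemma inner_stack: "stack x l \<bullet> stack y k = x \<bullet> y + l \<bullet> k"
  by (simp add: inner_vec_def sum_UNIV_Plus stack_def)

lemma wnorm_G_mat:
  "wnorm (G_mat B T \<alpha> \<beta>) (stack v l) = sqrt (v \<bullet> (M_mat B T \<alpha> *v v) + \<alpha> / \<beta> * (l \<bullet> l))"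
  by (simp add: wnorm_def G_mat_def block_diag_stack inner_stack flip: scaleR_matrix_vector_assoc)

theorem mainTheorem1:
  fixes E :: "'n::finite set set"
    and ends :: "'e::finite \<Rightarrow> 'n set"
    and A :: "real^'n^'e"
    and B :: "real^'n^'n"
    and f :: "'n \<Rightarrow> real \<Rightarrow> real"
    and m L \<alpha> \<beta> \<eta> :: real
    and T :: nat
    and x :: "nat \<Rightarrow> real^'n" and xstar :: "real^'n"
    and lam :: "nat \<Rightarrow> real^'e" and lamstar :: "real^'e"
  assumes n_ge_2: "CARD('n) \<ge> 2"
    and graph: "undirected_graph E"
    and incidence: "incidence_matrix E ends A"
    and connected: "null_space A = span {\<chi> i. 1}"
    and m_pos: "0 < m"
    and f_twice_diff: "\<And>i. twice_differentiable (f i)"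
    and f_strongly_convex: "\<And>i. strongly_convex m (f i)"
    and f_lipschitz: "\<And>i. L-lipschitz_on UNIV (deriv (f i))"
    and B_psd: "sym_psd B"
    and B_null: "null_space B = null_space A"
    and B_sparse: "\<And>i j. i \<noteq> j \<Longrightarrow> B $ i $ j \<noteq> 0 \<Longrightarrow> {i, j} \<in> E"
    and xstar: "primal_optimal (objective f) A xstar"
    and lamstar_opt: "dual_optimal (objective f) A lamstar"
    and lamstar_proj: "closest_point (null_space (transpose A)) lamstar = 0"
    and T_pos: "T \<ge> 1"
    and iterates: "primal_dual_iterates (objective f) A B T \<alpha> \<beta> x lam"
    and beta_pos: "0 < \<beta>"
    and beta_less: "\<beta> < 2 * m / max_eigenvalue (transpose A ** A)"
    and eta_pos: "0 < \<eta>"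
    and eta_less: "\<eta> < 2 * m - \<beta> * max_eigenvalue (transpose A ** A)"
    and alpha_pos: "0 < \<alpha>"
    and alpha_less: "\<alpha> < (1 - (L\<^sup>2 / (L\<^sup>2 + \<eta> * max_eigenvalue B)) powr (1 / real T))
                         / max_eigenvalue B"
  shows "(\<exists>\<delta>>0. \<forall>k.
            (wnorm (G_mat B T \<alpha> \<beta>) (stack (x (Suc k)) (lam (Suc k)) - stack xstar lamstar))\<^sup>2
              \<le> 1 / (1 + \<delta>) *
                (wnorm (G_mat B T \<alpha> \<beta>) (stack (x k) (lam k) - stack xstar lamstar))\<^sup>2)
       \<and> Q_linear (\<lambda>k. wnorm (G_mat B T \<alpha> \<beta>) (stack (x k) (lam k) - stack xstar lamstar))
       \<and> R_linear (\<lambda>k. wnorm (M_mat B T \<alpha>) (x k - xstar))"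
proof -
  let ?M = "M_mat B T \<alpha>" and ?C = "C_mat B T \<alpha>" and ?F = "objective f"
  let ?\<rho>A = "max_eigenvalue (transpose A ** A)" and ?\<rho>B = "max_eigenvalue B"
  let ?g = "\<lambda>k. gradient ?F (x k) - gradient ?F xstar"
  define N where "N v l = v \<bullet> (?M *v v) + \<alpha> / \<beta> * (l \<bullet> l)" for v :: "real^'n" and l :: "real^'e"
  have diff: "f i differentiable at y" for i y
    using f_twice_diff by (simp add: twice_differentiable_def)
  have L: "0 \<le> L" using f_lipschitz lipschitz_on_nonneg by blast

  have Ax: "A *v xstar = 0" and kkt: "gradient ?F xstar + transpose A *v lamstar = 0"
    using dual_optimal_stationary[of f, OF diff f_strongly_convex _ xstar lamstar_opt] m_pos by auto
  have Bx: "B *v xstar = 0" using Ax B_null by (auto simp: null_space_def)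

  have symB: "transpose B = B" and psd: "0 \<le> v \<bullet> (B *v v)" for v
    using B_psd by (auto simp: sym_psd_def)
  have upper: "v \<bullet> (B *v v) \<le> ?\<rho>B * (v \<bullet> v)" for v
    by (rule inner_le_max_eigenvalue[OF symB])
  have "0 \<le> ?\<rho>B"
  proof -
    \<comment> \<open>The form is tested at a unit vector; \<open>undefined\<close> stands for an
      arbitrary coordinate.\<close>
    have "0 \<le> ?\<rho>B * (axis undefined 1 \<bullet> (axis undefined 1 :: real^'n))"
      using psd upper by (rule order_trans)
    then show ?thesis by (simp add: inner_axis_axis)
  qed
  \<comment> \<open>If \<open>?\<rho>B\<close> were \<open>0\<close>, the step size bound would be the junk value \<open>_ / 0 = 0\<close>.\<close>
  moreover have "?\<rho>B \<noteq> 0" using alpha_less alpha_pos by auto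
  ultimately have rhoB: "0 < ?\<rho>B" by simp
  note coercive_facts = M_mat_coercive[OF symB rhoB alpha_pos eta_pos upper T_pos alpha_less]
  have inv: "invertible ?C" by (rule coercive_facts)
  obtain c where c: "0 < c"
    and coercive: "\<And>v. (\<alpha> * L\<^sup>2 / \<eta> + c) * (v \<bullet> v) \<le> v \<bullet> (?M *v v)"
    using coercive_facts(2) by auto
  have symM: "v \<bullet> (?M *v w) = (?M *v v) \<bullet> w" for v w
    by (rule inner_M_mat_symmetric[OF symB inv])
  have M_nonneg: "0 \<le> v \<bullet> (?M *v v)" for v
  proof -
    have "0 \<le> (\<alpha> * L\<^sup>2 / \<eta> + c) * (v \<bullet> v)" using c alpha_pos eta_pos by simp
    then show ?thesis using coercive[of v] by linarith
  qed
  have A_le: "(norm (A *v v))\<^sup>2 \<le> ?\<rho>A * (norm v)\<^sup>2" for v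
  proof -
    have "v \<bullet> ((transpose A ** A) *v v) \<le> ?\<rho>A * (v \<bullet> v)"
      by (rule inner_le_max_eigenvalue) (simp add: matrix_transpose_mul)
    moreover have "v \<bullet> ((transpose A ** A) *v v) = (A *v v) \<bullet> (A *v v)"
      using inner_matrix_vector_transpose[of v "transpose A" "A *v v"]
      by (simp only: transpose_transpose flip: matrix_vector_mul_assoc)
    ultimately show ?thesis by (simp add: power2_norm_eq_inner)
  qed

  have lam0: "lam 0 = 0" and xSuc: "x (Suc k) = ((primal_step ?F A B \<alpha> (x k) (lam k)) ^^ T) (x k)"
    and lamSuc: "lam (Suc k) = lam k + \<beta> *\<^sub>R (A *v x (Suc k))" for k
    using iterates by (auto simp: primal_dual_iterates_def)
  have "\<exists>w. lamstar = transpose (transpose A) *v w"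
  proof (rule orthogonal_to_kernel_in_range_transpose)
    fix v assume v: "transpose A *v v = 0"
    let ?K = "null_space (transpose A)"
    have sub: "subspace ?K"
      unfolding null_space_def by (intro linear_subspace_kernel matrix_vector_mul_linear)
    have "v \<in> ?K" "- v \<in> ?K" using v sub by (auto simp: null_space_def dest: subspace_neg)
    \<comment> \<open>The variational inequality for the projection 0 of \<open>lamstar\<close>,
      tested at v and -v, makes \<open>lamstar\<close> orthogonal to ker A'.\<close>
    then have "lamstar \<bullet> v \<le> 0" "lamstar \<bullet> (- v) \<le> 0"
      using closest_point_dot[OF subspace_imp_convex[OF sub] closed_subspace[OF sub], of _ lamstar]
        lamstar_proj by (metis diff_zero)+
    then show "v \<bullet> lamstar = 0" by (simp add: inner_commute)
  qed
  then obtain ws where ws: "lamstar = A *v ws" by auto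
  \<comment> \<open>The multipliers start at 0 and every dual update adds an image under
    \<open>A\<close>.\<close>
  have "\<exists>w. lam k = A *v w" for k
  proof (induction k)
    case 0
    show ?case using lam0 by (intro exI[of _ 0]) simp
  next
    case (Suc k)
    then obtain w where "lam k = A *v w" by blast
    then have "lam (Suc k) = A *v (w + \<beta> *\<^sub>R x (Suc k))"
      by (simp add: lamSuc matrix_vector_right_distrib matrix_vector_mult_scaleR)
    then show ?case by blast
  qed
  then obtain w where w: "\<And>k. lam k = A *v w k" by metis

  have step: "?M *v (x (Suc k) - x k) = - \<alpha> *\<^sub>R (?g k + transpose A *v (lam (Suc k) - lamstar)
      + (B *v (x (Suc k) - xstar) - \<beta> *\<^sub>R (transpose A *v (A *v (x (Suc k) - xstar)))))" for k
  proof -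
    let ?h = "gradient ?F (x k) + transpose A *v lam k"
    have "x (Suc k) = mat_pow (mat 1 - \<alpha> *\<^sub>R B) T *v x k - \<alpha> *\<^sub>R (?C *v ?h)"
      unfolding xSuc by (rule primal_step_funpow)
    \<comment> \<open>Applying the inverse of C exposes M at the old iterate; writing that inverse
      as M + \<alpha> B on the left then puts the B-term at the new iterate.\<close>
    then have "matrix_inv ?C *v x (Suc k) = ?M *v x k - \<alpha> *\<^sub>R ?h"
      by (simp add: M_mat_def matrix_vector_mult_diff_distrib matrix_vector_mult_scaleR
          matrix_inv_cancel[OF inv] flip: matrix_vector_mul_assoc)
    then have 1: "?M *v (x (Suc k) - x k) = - \<alpha> *\<^sub>R (?h + B *v x (Suc k))"
      unfolding M_mat_plus[OF inv]
      by (simp add: matrix_vector_mult_diff_distrib scaleR_right_distrib eq_diff_eq algebra_simps)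
    \<comment> \<open>Expressing the old multiplier through the new one produces the term -\<beta>
      A'A x; A x* = 0 and B x* = 0 then allow the new iterate to be replaced by its error.\<close>
    have "transpose A *v lam k = transpose A *v (lam (Suc k) - lamstar) + transpose A *v lamstar
        - \<beta> *\<^sub>R (transpose A *v (A *v x (Suc k)))"
      unfolding lamSuc by (simp only: matrix_vector_right_distrib matrix_vector_mult_diff_distrib
          matrix_vector_mult_scaleR) simp
    moreover have "transpose A *v lamstar = - gradient ?F xstar"
      using kkt by (simp only: add_eq_0_iff)
    ultimately have 2: "?h = ?g k + transpose A *v (lam (Suc k) - lamstar)
        - \<beta> *\<^sub>R (transpose A *v (A *v x (Suc k)))"
      by simp
    show ?thesis
      unfolding 1 2 matrix_vector_mult_diff_distrib[of B] matrix_vector_mult_diff_distrib[of A] Ax Bx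
      by simp
  qed

  obtain \<delta> where \<delta>: "\<delta> > 0"
    and contract: "\<And>k. (1 + \<delta>) * N (x (Suc k) - xstar) (lam (Suc k) - lamstar)
        \<le> N (x k - xstar) (lam k - lamstar)"
  proof -
    obtain \<delta> where \<delta>: "\<delta> > 0" and *: "\<And>e d g g' u w. m * (norm e)\<^sup>2 \<le> e \<bullet> g' \<Longrightarrow>
      norm (g' - g) \<le> L * norm d \<Longrightarrow> norm g \<le> L * norm (e - d) \<Longrightarrow> u = A *v w \<Longrightarrow>
      ?M *v d = - \<alpha> *\<^sub>R (g + transpose A *v u + (B *v e - \<beta> *\<^sub>R (transpose A *v (A *v e)))) \<Longrightarrow>
      (1 + \<delta>) * N e u \<le> N (e - d) (u - \<beta> *\<^sub>R (A *v e))"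
      using energy_contraction[OF symM coercive c alpha_pos beta_pos eta_pos L A_le eta_less psd]
      unfolding N_def by blast
    show ?thesis
    proof (rule that[OF \<delta>])
      fix k
      \<comment> \<open>The arguments on the right are the old errors in disguise, the dual one
        because A x* = 0.\<close>
      have "(1 + \<delta>) * N (x (Suc k) - xstar) (lam (Suc k) - lamstar)
          \<le> N (x (Suc k) - xstar - (x (Suc k) - x k))
              (lam (Suc k) - lamstar - \<beta> *\<^sub>R (A *v (x (Suc k) - xstar)))"
      proof (rule *[OF _ _ _ _ step])
        show "m * (norm (x (Suc k) - xstar))\<^sup>2 \<le> (x (Suc k) - xstar) \<bullet> ?g (Suc k)"
          by (rule gradient_objective_monotone[of f, OF diff f_strongly_convex])
        show "norm (?g (Suc k) - ?g k) \<le> L * norm (x (Suc k) - x k)"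
          using gradient_objective_lipschitz[of f, OF diff f_lipschitz, of "x (Suc k)" "x k"] by simp
        show "norm (?g k) \<le> L * norm (x (Suc k) - xstar - (x (Suc k) - x k))"
          using gradient_objective_lipschitz[of f, OF diff f_lipschitz, of "x k" xstar] by simp
        show "lam (Suc k) - lamstar = A *v (w (Suc k) - ws)"
          by (simp add: w ws matrix_vector_mult_diff_distrib)
      qed
      then show "(1 + \<delta>) * N (x (Suc k) - xstar) (lam (Suc k) - lamstar)
          \<le> N (x k - xstar) (lam k - lamstar)"
        by (simp add: lamSuc matrix_vector_mult_diff_distrib Ax)
    qed
  qed

  let ?z = "\<lambda>k. wnorm (G_mat B T \<alpha> \<beta>) (stack (x k) (lam k) - stack xstar lamstar)"
  have z: "?z k = sqrt (N (x k - xstar) (lam k - lamstar))" for k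
    unfolding stack_diff wnorm_G_mat N_def ..
  have N_nonneg: "0 \<le> N v l" for v l
    using M_nonneg[of v] alpha_pos beta_pos by (simp add: N_def)
  have sq: "(?z (Suc k))\<^sup>2 \<le> 1 / (1 + \<delta>) * (?z k)\<^sup>2" for k
    using contract[of k] \<delta> N_nonneg by (simp add: z pos_le_divide_eq mult.commute)
  have Q: "Q_linear ?z"
    unfolding Q_linear_def
  \<comment> \<open>The squared norms contract by 1 / (1 + \<delta>), so the norms contract by its
    square root.\<close>
  proof (intro conjI allI exI[of _ "sqrt (1 / (1 + \<delta>))"])
    show "0 \<le> ?z k" for k by (simp add: z N_nonneg)
    show "?z (Suc k) \<le> sqrt (1 / (1 + \<delta>)) * ?z k" for k
      using real_sqrt_le_mono[OF sq[of k]] unfolding real_sqrt_mult by (simp only: z real_sqrt_abs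
          real_sqrt_ge_zero N_nonneg abs_of_nonneg)
  qed (use \<delta> in auto)
  have "R_linear (\<lambda>k. wnorm ?M (x k - xstar))"
    unfolding R_linear_def
  proof (intro conjI allI exI[of _ ?z] Q)
    show "0 \<le> wnorm ?M (x k - xstar)" for k by (simp add: wnorm_def M_nonneg)
    \<comment> \<open>Dropping the nonnegative dual part of the G-norm leaves the M-norm.\<close>
    show "wnorm ?M (x k - xstar) \<le> ?z k" for k
      unfolding z unfolding wnorm_def N_def using alpha_pos beta_pos by simp
  qed
  then show ?thesis using \<delta> sq Q by blast
qed

end
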